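(* Let $\mu,\nu,t\in\mathbb{C}$ with $\Re(\mu+\nu)>-1$, and let $r_N,\bar r_N$ ($N\ge0$) be the reflection coefficients of the orthogonal polynomial system on the unit circle with weight $w(z)=(1+z)^{\mu}(1+1/z)^{\nu}e^{tz}$, where it is assumed that the Toeplitz determinants $I^0_N[w]$ are nonzero for all $N\ge1$. Then for all $N\ge1$ the reflection coefficients satisfy the coupled recurrence relations $$(1-r_N\bar r_N)\,[\,t\,r_{N+1}+(N+\nu)r_N\,]\,[\,t\,\bar r_{N-1}+(N+\nu)\bar r_N\,]=[(N+\nu)r_N\bar r_N+\mu]\,[\nu-(N+\nu)r_N\bar r_N],$$ $$t^2r_N^2\bar r_{N-1}^2+t(\nu-\mu-t)\,r_N\bar r_{N-1}-(N+\nu)(N-1+\nu)\,\bar r_N r_{N-1}-(N-1+\nu)\,t\,r_{N-1}\bar r_{N-1}-(N+\nu)\,t\,r_N\bar r_N-\mu\nu=0.$$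
   Context: On the unit circle, $w(e^{i\theta})=e^{i\theta(\mu-\nu)/2}\,|1+e^{i\theta}|^{\mu+\nu}\,e^{te^{i\theta}}$ for $-\pi<\theta\le\pi$ (principal branches). Its Fourier coefficients are $w_k=\frac1{2\pi}\int_{-\pi}^{\pi}w(e^{i\theta})e^{-ik\theta}\,d\theta$, $k\in\mathbb{Z}$. For $\epsilon\in\{0,1,-1\}$ put $I^\epsilon_N[w]=\det[w_{-\epsilon+j-k}]_{0\le j,k\le N-1}$, $I^\epsilon_0[w]=1$. The reflection coefficients are $r_N=(-1)^N I^1_N[w]/I^0_N[w]$ and $\bar r_N=(-1)^N I^{-1}_N[w]/I^0_N[w]$ (so $r_0=\bar r_0=1$); these are in general two independent quantities and the bar does not mean complex conjugation. *)

theory Defs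
  imports "HOL-Analysis.Analysis" "Jordan_Normal_Form.Determinant"
begin

text \<open>
  The weight \<open>(1 + z)^\<mu> (1 + 1/z)^\<nu> e^(t z)\<close> with principal branches of the powers. The lemma
  below gives its values on the unit circle. At \<open>z = -1\<close> it is \<open>0\<close> because \<open>0 powr a = 0\<close>;
  this single point does not affect the Fourier coefficients.
\<close>

definition weight :: "complex \<Rightarrow> complex \<Rightarrow> complex \<Rightarrow> complex \<Rightarrow> complex" where
  "weight \<mu> \<nu> t z = (1 + z) powr \<mu> * (1 + 1 / z) powr \<nu> * exp (t * z)"

lemma weight_cis:
  assumes "- pi < \<theta>" "\<theta> \<le> pi"
  shows "weight \<mu> \<nu> t (cis \<theta>) =
    exp (\<i> * of_real \<theta> * (\<mu> - \<nu>) / 2) * of_real (cmod (1 + cis \<theta>)) powr (\<mu> + \<nu>) * exp (t * cis \<theta>)"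
proof (cases "\<theta> = pi")
  case True
  then show ?thesis by (simp add: weight_def)
next
  case False
  define r where "r = 2 * cos (\<theta> / 2)"
  have r: "r > 0"
    using assms False by (auto simp: r_def intro!: cos_gt_zero_pi)
  have c: "cos \<theta> = 2 * cos (\<theta>/2) ^ 2 - 1" "sin \<theta> = 2 * sin (\<theta>/2) * cos (\<theta>/2)"
    using cos_double_cos[of "\<theta>/2"] sin_double[of "\<theta>/2"] by auto
  have e: "exp (\<i> * of_real (\<theta> / 2)) = cis (\<theta> / 2)" "exp (- (\<i> * of_real (\<theta> / 2))) = cis (- (\<theta> / 2))"
    by (simp_all add: cis_conv_exp)
  have i: "1 / cis \<theta> = cis (- \<theta>)"
    by (simp add: divide_inverse)
  have 1: "1 + cis \<theta> = of_real r * exp (\<i> * of_real (\<theta> / 2))"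
    unfolding e by (simp add: complex_eq_iff r_def c power2_eq_square)
  have 2: "1 + 1 / cis \<theta> = of_real r * exp (- (\<i> * of_real (\<theta> / 2)))"
    unfolding e i by (simp add: complex_eq_iff r_def c power2_eq_square)
  have n: "cmod (1 + cis \<theta>) = r"
    unfolding 1 using r by (simp add: norm_mult)
  have L: "Ln (of_real r * exp w) = of_real (ln r) + w" if "- pi < Im w" "Im w \<le> pi" for w
    using Ln_times_of_real[OF r, of "exp w"] that r by (simp add: Ln_of_real)
  have "Ln (1 + cis \<theta>) = of_real (ln r) + \<i> * of_real (\<theta> / 2)"
    unfolding 1 by (rule L) (use assms in auto)
  moreover have "Ln (1 + 1 / cis \<theta>) = of_real (ln r) - \<i> * of_real (\<theta> / 2)"
    unfolding 2 using assms by (subst L) auto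
  moreover have "1 + cis \<theta> \<noteq> 0" "1 + 1 / cis \<theta> \<noteq> 0"
    unfolding 1 2 using r by auto
  ultimately show ?thesis
    unfolding n weight_def using r
    by (simp add: powr_def Ln_of_real exp_add[symmetric] mult_ac) (simp add: algebra_simps diff_divide_distrib)
qed

definition fourier_coeff :: "(complex \<Rightarrow> complex) \<Rightarrow> int \<Rightarrow> complex" where
  "fourier_coeff w k =
    1 / (2 * of_real pi) * integral {- pi..pi} (\<lambda>\<theta>. w (cis \<theta>) * exp (- \<i> * of_int k * of_real \<theta>))"

text \<open>The \<open>N \<times> N\<close> Toeplitz determinant \<open>I\<^sup>\<epsilon>\<^sub>N[w]\<close>; the empty determinant is \<open>1\<close>.\<close>

definition toeplitz_det :: "int \<Rightarrow> nat \<Rightarrow> (complex \<Rightarrow> complex) \<Rightarrow> complex" where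
  "toeplitz_det \<epsilon> N w =
    Determinant.det (Matrix.mat N N (\<lambda>(j, k). fourier_coeff w (- \<epsilon> + int j - int k)))"

text \<open>
  The two families of reflection coefficients \<open>r\<^sub>N\<close> and \<open>r\<close>-bar \<open>\<^sub>N\<close>. The bar is part of the name:
  in general the second is not the complex conjugate of the first.
\<close>

definition refl_coeff :: "(complex \<Rightarrow> complex) \<Rightarrow> nat \<Rightarrow> complex" where
  "refl_coeff w N = (-1) ^ N * toeplitz_det 1 N w / toeplitz_det 0 N w"

definition refl_coeff_bar :: "(complex \<Rightarrow> complex) \<Rightarrow> nat \<Rightarrow> complex" where
  "refl_coeff_bar w N = (-1) ^ N * toeplitz_det (-1) N w / toeplitz_det 0 N w"

end

theory Submission
  imports Defs
begin

text \<open>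
  Integrating the derivative of \<open>(1 + z) w(z) z\<^sup>-\<^sup>k\<close> gives a three-term recurrence for the Fourier
  coefficients of the weight; everything else is algebra. Let \<open>P\<^sub>N\<close> be the monic orthogonal polynomial
  and \<open>Q\<^sub>N\<close> the reversed dual one, so that \<open>P\<^sub>N(0) = r\<^sub>N\<close> and \<open>rb\<^sub>N\<close> is the coefficient of \<open>z\<^sup>N\<close> in \<open>Q\<^sub>N\<close>.
  The recurrence determines the moments of \<open>z(1 + z) P\<^sub>N'\<close> and \<open>z(1 + z) Q\<^sub>N'\<close>, and comparing moments
  expresses both as polynomial combinations of \<open>P\<^sub>N\<close> and \<open>Q\<^sub>N\<close> with explicit coefficients in the
  reflection coefficients. At \<open>z = -1\<close> the derivatives drop out, leaving two homogeneous linear equations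
  for \<open>(P\<^sub>N(-1), Q\<^sub>N(-1))\<close>. This vector is nonzero by the Szego recurrence, so their determinant
  vanishes, which is the second relation. The first relation is the same determinant for the vector
  \<open>(P\<^sub>N(-1), Q\<^bsub>N-1\<^esub>(-1))\<close>.
\<close>

section \<open>Moments of polynomials\<close>

text \<open>\<open>moment c m p\<close> is the integral of \<open>z\<^sup>-\<^sup>m p(z)\<close> against the weight with Fourier coefficients \<open>c\<close>.\<close>

definition moment :: "(int \<Rightarrow> 'a::comm_ring_1) \<Rightarrow> int \<Rightarrow> 'a poly \<Rightarrow> 'a" where
  "moment c m p = (\<Sum>i\<le>degree p. coeff p i * c (m - int i))"

lemma moment_eq_sum:
  assumes "degree p \<le> n"
  shows "moment c m p = (\<Sum>i\<le>n. coeff p i * c (m - int i))"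
  unfolding moment_def using assms
  by (intro sum.mono_neutral_left) (auto simp: coeff_eq_0)

lemma moment_0 [simp]: "moment c m 0 = 0"
  by (simp add: moment_def)

lemma moment_add: "moment c m (p + q) = moment c m p + moment c m q"
proof -
  let ?n = "max (degree p) (degree q)"
  have "degree (p + q) \<le> ?n" by (rule degree_add_le) auto
  then show ?thesis
    by (simp add: moment_eq_sum[of _ ?n] sum.distrib algebra_simps)
qed

lemma moment_diff: "moment c m (p - q) = moment c m p - moment c m q"
  using moment_add[of c m "p - q" q] by simp

lemma moment_minus: "moment c m (- p) = - moment c m p"
  using moment_diff[of c m 0 p] by simp

lemma moment_smult: "moment c m (Polynomial.smult a p) = a * moment c m p"
  by (simp add: moment_eq_sum[of _ "degree p"] degree_smult_le sum_distrib_left mult.assoc)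

lemma moment_pCons: "moment c m (pCons a p) = a * c m + moment c (m - 1) p"
proof -
  have "moment c m (pCons a p) = (\<Sum>i\<le>Suc (degree p). coeff (pCons a p) i * c (m - int i))"
    by (rule moment_eq_sum) (rule degree_pCons_le)
  then show ?thesis
    by (simp only: sum.atMost_Suc_shift) (simp add: moment_def algebra_simps)
qed

text \<open>Integration by parts in moment form: for \<open>p = z^i\<close> the identity is
  \<open>rec\<close> at \<open>k = m - i\<close>, the factor \<open>i\<close> from the derivative
  making up the shift.\<close>

lemma moment_X_pderiv:
  fixes \<mu> \<nu> t :: "'a::idom"
  assumes rec: "\<And>k. (of_int k + \<nu>) * c k + (of_int k - 1 - \<mu> - t) * c (k - 1) - t * c (k - 2) = 0"
  shows "moment c m ([:0, 1, 1:] * pderiv p) =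
    (of_int m + \<nu>) * moment c m p + (of_int m - 1 - \<mu> - t) * moment c (m - 1) p
    - t * moment c (m - 2) p"
proof (induction p arbitrary: m)
  case 0
  then show ?case by simp
next
  case (pCons a p)
  have "[:0, 1, 1:] * pderiv (pCons a p)
      = pCons 0 p + pCons 0 (pCons 0 p) + pCons 0 ([:0, 1, 1:] * pderiv p)"
    by (simp add: pderiv_pCons algebra_simps)
  then have "moment c m ([:0, 1, 1:] * pderiv (pCons a p))
      = moment c (m - 1) p + moment c (m - 2) p + moment c (m - 1) ([:0, 1, 1:] * pderiv p)"
    by (simp only: moment_add moment_pCons) simp
  also have "\<dots> = (of_int m + \<nu>) * moment c (m - 1) p
      + (of_int m - 1 - \<mu> - t) * moment c (m - 2) p - t * moment c (m - 3) p"
    unfolding pCons.IH by (simp add: algebra_simps)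
  \<comment> \<open>The added term is zero by \<open>rec\<close>; it supplies the share of
    \<open>a\<close>, which the derivative loses.\<close>
  also have "\<dots> = \<dots> +
      a * ((of_int m + \<nu>) * c m + (of_int m - 1 - \<mu> - t) * c (m - 1) - t * c (m - 2))"
    by (simp add: rec)
  finally show ?case
    by (simp add: moment_pCons algebra_simps)
qed

section \<open>Toeplitz matrices and cofactor polynomials\<close>

definition toeplitz :: "(int \<Rightarrow> 'a) \<Rightarrow> nat \<Rightarrow> 'a Matrix.mat" where
  "toeplitz c n = Matrix.mat n n (\<lambda>(j, k). c (int j - int k))"

lemma toeplitz_carrier [simp]: "toeplitz c n \<in> carrier_mat n n"
  by (simp add: toeplitz_def)

text \<open>These moments are the entries of the Toeplitz matrix applied to the coefficient vector.
  All later polynomial identities rest on this uniqueness.\<close>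

lemma poly_eq_0_if_moments_eq_0:
  fixes c :: "int \<Rightarrow> 'a::field"
  assumes det: "Determinant.det (toeplitz c n) \<noteq> 0"
    and deg: "\<And>i. n \<le> i \<Longrightarrow> coeff p i = 0"
    and mom: "\<And>m. m < n \<Longrightarrow> moment c (int m) p = 0"
  shows "p = 0"
proof (cases n)
  case 0
  then show ?thesis using deg by (intro poly_eqI) simp
next
  case (Suc k)
  define v where "v = Matrix.vec n (coeff p)"
  have d: "degree p \<le> k"
    using deg Suc by (intro degree_le) auto
  have "toeplitz c n *\<^sub>v v = 0\<^sub>v n"
  proof (rule eq_vecI)
    fix m assume m: "m < dim_vec (0\<^sub>v n :: 'a Matrix.vec)"
    then have "vec_index (toeplitz c n *\<^sub>v v) m = (\<Sum>i<n. c (int m - int i) * coeff p i)"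
      by (simp add: toeplitz_def v_def scalar_prod_def atLeast0LessThan)
    also have "\<dots> = moment c (int m) p"
      using moment_eq_sum[OF d, of c "int m"] Suc by (simp add: lessThan_Suc_atMost mult.commute)
    finally show "vec_index (toeplitz c n *\<^sub>v v) m = vec_index (0\<^sub>v n) m"
      using mom m by simp
  qed (simp add: toeplitz_def)
  moreover have "v \<in> carrier_vec n" by (simp add: v_def)
  ultimately have v: "v = 0\<^sub>v n"
    using det det_0_iff_vec_prod_zero_field[of "toeplitz c n" n] by auto
  show ?thesis
  proof (rule poly_eqI)
    fix i
    show "coeff p i = coeff 0 i"
      using deg arg_cong[OF v, of "\<lambda>v. vec_index v i"] by (cases "i < n") (auto simp: v_def)
  qed
qed

text \<open>The determinant of \<open>toeplitz c (Suc n)\<close> with row \<open>s\<close> replaced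
  by \<open>1, z, ..., z^n\<close>, expanded along that row and normalised.\<close>

definition cofactor_poly :: "(int \<Rightarrow> 'a::field) \<Rightarrow> nat \<Rightarrow> nat \<Rightarrow> 'a poly" where
  "cofactor_poly c n s =
    (\<Sum>k\<le>n. monom (cofactor (toeplitz c (Suc n)) s k / Determinant.det (toeplitz c n)) k)"

lemma coeff_cofactor_poly:
  "coeff (cofactor_poly c n s) k =
    (if k \<le> n then cofactor (toeplitz c (Suc n)) s k / Determinant.det (toeplitz c n) else 0)"
  by (simp add: cofactor_poly_def coeff_sum)

lemma moment_cofactor_poly:
  assumes "m \<le> n" "s \<le> n"
  shows "moment c (int m) (cofactor_poly c n s) =
    (if m = s then Determinant.det (toeplitz c (Suc n)) / Determinant.det (toeplitz c n) else 0)"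
proof -
  let ?A = "toeplitz c (Suc n)" and ?D = "Determinant.det (toeplitz c n)"
  have "degree (cofactor_poly c n s) \<le> n"
    by (rule degree_le) (simp add: coeff_cofactor_poly)
  then have "moment c (int m) (cofactor_poly c n s)
      = (\<Sum>k\<le>n. c (int m - int k) * cofactor ?A s k) / ?D"
    by (simp add: moment_eq_sum coeff_cofactor_poly sum_divide_distrib mult.commute)
  also have "(\<Sum>k\<le>n. c (int m - int k) * cofactor ?A s k) = (?A * adj_mat ?A) $$ (m, s)"
    using assms by (simp add: adj_mat_def toeplitz_def scalar_prod_def atLeast0_lessThan_Suc
        atLeast0LessThan lessThan_Suc_atMost)
  also have "?A * adj_mat ?A = Determinant.det ?A \<cdot>\<^sub>m 1\<^sub>m (Suc n)"
    by (rule adj_mat) simp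
  finally show ?thesis
    using assms by simp
qed

section \<open>Biorthogonal polynomials\<close>

locale regular_moments =
  fixes c :: "int \<Rightarrow> 'a::field"
  assumes regular: "Determinant.det (toeplitz c n) \<noteq> 0"
begin

text \<open>
  \<open>P n\<close> and \<open>z\<^sup>-\<^sup>n Q n\<close> are the monic biorthogonal polynomials in \<open>z\<close> and \<open>1/z\<close>; working with \<open>Q n\<close>
  avoids Laurent polynomials.
\<close>

definition P :: "nat \<Rightarrow> 'a poly" where "P n = cofactor_poly c n n"
definition Q :: "nat \<Rightarrow> 'a poly" where "Q n = cofactor_poly c n 0"
definition h :: "nat \<Rightarrow> 'a" where
  "h n = Determinant.det (toeplitz c (Suc n)) / Determinant.det (toeplitz c n)"
definition r :: "nat \<Rightarrow> 'a" where "r n = coeff (P n) 0"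
definition rb :: "nat \<Rightarrow> 'a" where "rb n = coeff (Q n) n"

lemma r_eq:
  "r n = (-1) ^ n * Determinant.det (Matrix.mat n n (\<lambda>(j, k). c (- 1 + int j - int k)))
    / Determinant.det (toeplitz c n)"
proof -
  have "mat_delete (toeplitz c (Suc n)) n 0 = Matrix.mat n n (\<lambda>(j, k). c (- 1 + int j - int k))"
    by (rule eq_matI) (auto simp: mat_delete_def toeplitz_def algebra_simps)
  then show ?thesis
    by (simp add: r_def P_def coeff_cofactor_poly Determinant.cofactor_def)
qed

lemma rb_eq:
  "rb n = (-1) ^ n * Determinant.det (Matrix.mat n n (\<lambda>(j, k). c (1 + int j - int k)))
    / Determinant.det (toeplitz c n)"
proof -
  have "mat_delete (toeplitz c (Suc n)) 0 n = Matrix.mat n n (\<lambda>(j, k). c (1 + int j - int k))"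
    by (rule eq_matI) (auto simp: mat_delete_def toeplitz_def algebra_simps)
  then show ?thesis
    by (simp add: rb_def Q_def coeff_cofactor_poly Determinant.cofactor_def)
qed

lemma coeff_P_top [simp]: "coeff (P n) n = 1"
proof -
  have "mat_delete (toeplitz c (Suc n)) n n = toeplitz c n"
    by (rule eq_matI) (auto simp: mat_delete_def toeplitz_def)
  then show ?thesis
    using regular by (simp add: P_def coeff_cofactor_poly Determinant.cofactor_def)
qed

lemma coeff_Q_0 [simp]: "coeff (Q n) 0 = 1"
proof -
  have "mat_delete (toeplitz c (Suc n)) 0 0 = toeplitz c n"
    by (rule eq_matI) (auto simp: mat_delete_def toeplitz_def)
  then show ?thesis
    using regular by (simp add: Q_def coeff_cofactor_poly Determinant.cofactor_def)
qed

lemma coeff_P_0 [simp]: "coeff (P n) 0 = r n"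
  and coeff_Q_top [simp]: "coeff (Q n) n = rb n"
  by (simp_all add: r_def rb_def)

lemma coeff_P_above [simp]: "n < i \<Longrightarrow> coeff (P n) i = 0"
  and coeff_Q_above [simp]: "n < i \<Longrightarrow> coeff (Q n) i = 0"
  by (simp_all add: P_def Q_def coeff_cofactor_poly)

lemma h_nz [simp]: "h n \<noteq> 0"
  using regular by (simp add: h_def)

lemma moment_P_top: "moment c (int n) (P n) = h n"
  by (simp add: P_def moment_cofactor_poly h_def)

lemma moment_P_eq_0: "0 \<le> m \<Longrightarrow> m < int n \<Longrightarrow> moment c m (P n) = 0"
  using moment_cofactor_poly[of "nat m" n n c] by (simp add: P_def nat_less_iff)

lemma moment_Q_0: "moment c 0 (Q n) = h n"
  using moment_cofactor_poly[of 0 n 0 c] by (simp add: Q_def h_def)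

lemma moment_Q_eq_0: "0 < m \<Longrightarrow> m \<le> int n \<Longrightarrow> moment c m (Q n) = 0"
  using moment_cofactor_poly[of "nat m" n 0 c] by (simp add: Q_def nat_le_iff)

text \<open>Divide by \<open>z\<close>. The window \<open>1..n\<close> is where the moments of both
  \<open>z P n\<close> and \<open>Q n\<close> vanish.\<close>

lemma poly_eq_0_if_shifted_moments_eq_0:
  assumes "coeff p 0 = 0" "\<And>i. n < i \<Longrightarrow> coeff p i = 0"
    and "\<And>m. 0 < m \<Longrightarrow> m \<le> int n \<Longrightarrow> moment c m p = 0"
  shows "p = 0"
proof -
  obtain q where p: "p = pCons 0 q"
    using assms(1) by (cases p) auto
  have "q = 0"
  proof (rule poly_eq_0_if_moments_eq_0[OF regular[of n]])
    fix m assume "m < n"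
    then show "moment c (int m) q = 0"
      using assms(3)[of "int m + 1"] by (simp add: p moment_pCons)
  next
    fix i assume "n \<le> i"
    then show "coeff q i = 0"
      using assms(2)[of "Suc i"] by (simp add: p)
  qed
  then show ?thesis by (simp add: p)
qed

text \<open>Szego recurrence: the moments \<open>1..n\<close> of all three polynomials vanish, and
  the two sides agree in the constant and the leading coefficient.\<close>

lemma P_Suc: "P (Suc n) = pCons 0 (P n) + Polynomial.smult (r (Suc n)) (Q n)"
proof -
  let ?p = "P (Suc n) - (pCons 0 (P n) + Polynomial.smult (r (Suc n)) (Q n))"
  have "?p = 0"
  proof (rule poly_eq_0_if_shifted_moments_eq_0[of _ n])
    fix i assume "n < i"
    then show "coeff ?p i = 0"
      by (cases i; cases "i = Suc n") auto
  qed (auto simp: moment_diff moment_add moment_smult moment_pCons moment_P_eq_0 moment_Q_eq_0)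
  then show ?thesis by simp
qed

lemma Q_Suc: "Q (Suc n) = Q n + Polynomial.smult (rb (Suc n)) (pCons 0 (P n))"
proof -
  let ?p = "Q (Suc n) - (Q n + Polynomial.smult (rb (Suc n)) (pCons 0 (P n)))"
  have "?p = 0"
  proof (rule poly_eq_0_if_shifted_moments_eq_0[of _ n])
    fix i assume "n < i"
    then show "coeff ?p i = 0"
      by (cases i; cases "i = Suc n") auto
  qed (auto simp: moment_diff moment_add moment_smult moment_pCons moment_P_eq_0 moment_Q_eq_0)
  then show ?thesis by simp
qed

lemma moment_P_below: "moment c (-1) (P n) = - r (Suc n) * h n"
proof -
  have "moment c 0 (P (Suc n)) = 0" by (rule moment_P_eq_0) auto
  then show ?thesis
    by (simp add: P_Suc moment_add moment_smult moment_pCons moment_Q_0 add_eq_0_iff)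
qed

lemma moment_Q_above: "moment c (int n + 1) (Q n) = - rb (Suc n) * h n"
proof -
  have "moment c (int n + 1) (Q (Suc n)) = 0" by (rule moment_Q_eq_0) auto
  then show ?thesis
    by (simp add: Q_Suc moment_add moment_smult moment_pCons moment_P_top add_eq_0_iff)
qed

lemma rb_0 [simp]: "rb 0 = 1"
  by (simp only: rb_def coeff_Q_0)

text \<open>The factor is the ratio of consecutive norms \<open>h\<close>.\<close>

lemma one_minus_r_rb_nz: "1 - r (Suc n) * rb (Suc n) \<noteq> 0"
proof -
  have "h (Suc n) = h n * (1 - r (Suc n) * rb (Suc n))"
    using moment_Q_0[of "Suc n"]
    by (simp add: Q_Suc moment_add moment_smult moment_pCons moment_Q_0 moment_P_below
        algebra_simps)
  then show ?thesis
    using h_nz[of "Suc n"] by auto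
qed

text \<open>The transfer matrix of the Szego recurrence at \<open>z\<close> has determinant \<open>z (1 - r\<^sub>N rb\<^sub>N)\<close>.\<close>

lemma P_Q_no_common_root:
  assumes "z \<noteq> 0"
  shows "\<not> (poly (P n) z = 0 \<and> poly (Q n) z = 0)"
proof (induction n)
  case 0
  have "Q 0 = 1"
    by (rule poly_eqI) (auto simp: coeff_pCons one_pCons split: nat.split)
  then show ?case by simp
next
  case (Suc n)
  have "z * (1 - r (Suc n) * rb (Suc n)) * poly (P n) z
      = poly (P (Suc n)) z - r (Suc n) * poly (Q (Suc n)) z"
    and "(1 - r (Suc n) * rb (Suc n)) * poly (Q n) z
      = poly (Q (Suc n)) z - rb (Suc n) * poly (P (Suc n)) z"
    by (simp_all add: P_Suc Q_Suc algebra_simps)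
  then show ?case
    using Suc one_minus_r_rb_nz[of n] assms by auto
qed

end

section \<open>Recurrences for the reflection coefficients\<close>

lemma det_eq_0_if_kernel:
  fixes a b a' b' x y :: "'a::idom"
  assumes 1: "a * x = b * y" and 2: "a' * x = b' * y" and 3: "\<not> (x = 0 \<and> y = 0)"
  shows "a * b' = b * a'"
proof -
  have "(a * b') * x = b' * (a * x)" by (simp add: mult_ac)
  also have "\<dots> = b * (b' * y)" by (simp only: 1) (simp add: mult_ac)
  also have "\<dots> = (b * a') * x" by (simp only: 2[symmetric]) (simp add: mult_ac)
  finally have x: "(a * b') * x = (b * a') * x" .
  have "(a * b') * y = a * (b' * y)" by (simp add: mult_ac)
  also have "\<dots> = a' * (a * x)" by (simp only: 2[symmetric]) (simp add: mult_ac)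
  also have "\<dots> = (b * a') * y" by (simp only: 1) (simp add: mult_ac)
  finally show ?thesis
    using x 3 by (metis mult_right_cancel)
qed

text \<open>\<open>moment_rec\<close> is the moment form of the Pearson equation
  \<open>z(1+z) w' = (t z^2 + (t+\<mu>) z - \<nu>) w\<close>.\<close>

locale semiclassical_moments = regular_moments c for c :: "int \<Rightarrow> 'a::field" +
  fixes \<mu> \<nu> t :: 'a
  assumes moment_rec:
    "(of_int k + \<nu>) * c k + (of_int k - 1 - \<mu> - t) * c (k - 1) - t * c (k - 2) = 0"
begin

text \<open>The four coefficients on the right are forced by the moment \<open>n\<close>, the moment
  \<open>1\<close>, the value at \<open>0\<close> and the coefficient of
  \<open>z^(n+1)\<close>.\<close>

lemma P_diff_eq:
  "[:0, 1, 1:] * pderiv (P n) =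
    [:of_nat n + \<nu>, of_nat n - t * r (Suc n) * rb n:] * P n
    + [:- (of_nat n + \<nu>) * r n, t * r (Suc n):] * Q n"
proof -
  let ?p = "[:0, 1, 1:] * pderiv (P n) -
    ([:of_nat n + \<nu>, of_nat n - t * r (Suc n) * rb n:] * P n
    + [:- (of_nat n + \<nu>) * r n, t * r (Suc n):] * Q n)"
  have "?p = 0"
  proof (rule poly_eq_0_if_shifted_moments_eq_0[of _ n])
    fix m :: int assume m: "0 < m" "m \<le> int n"
    have "moment c m (P n) = (if m = int n then h n else 0)"
      using m by (auto simp: moment_P_top moment_P_eq_0)
    moreover have "moment c (m - 1) (P n) = 0"
      using m by (intro moment_P_eq_0) auto
    moreover have "moment c (m - 2) (P n) = (if m = 1 then - r (Suc n) * h n else 0)"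
      using m by (auto simp: moment_P_below moment_P_eq_0)
    moreover have "moment c m (Q n) = 0"
      using m by (rule moment_Q_eq_0)
    moreover have "moment c (m - 1) (Q n) = (if m = 1 then h n else 0)"
      using m by (auto simp: moment_Q_0 moment_Q_eq_0)
    ultimately show "moment c m ?p = 0"
      unfolding moment_diff moment_X_pderiv[OF moment_rec]
      by (simp add: moment_add moment_smult moment_pCons algebra_simps)
  next
    fix i assume "n < i"
    then show "coeff ?p i = 0"
      by (cases i; cases "i = Suc n")
        (auto simp: coeff_pderiv coeff_pCons algebra_simps split: nat.split)
  qed (simp add: coeff_pCons algebra_simps)
  then show ?thesis by simp
qed

text \<open>The term \<open>-t z^2 Q n\<close> cancels the moments \<open>m - 2\<close> of
  \<open>Q n\<close>, so the one at \<open>m = 1\<close> need not be known;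
  \<open>t rb n z^2 P n\<close> then removes the coefficient of \<open>z^(n+2)\<close>.\<close>

lemma Q_diff_eq:
  "[:0, 1, 1:] * pderiv (Q n) =
    [:0, - (of_nat n + 1 + \<nu>) * rb (Suc n), t * rb n:] * P n
    + [:0, t * r (Suc n) * rb n - t - \<mu>, - t:] * Q n"
proof -
  let ?p = "[:0, 1, 1:] * pderiv (Q n) -
    ([:0, - (of_nat n + 1 + \<nu>) * rb (Suc n), t * rb n:] * P n
    + [:0, t * r (Suc n) * rb n - t - \<mu>, - t:] * Q n)"
  have "?p = 0"
  proof (rule poly_eq_0_if_shifted_moments_eq_0[of _ "Suc n"])
    fix m :: int assume m: "0 < m" "m \<le> int (Suc n)"
    have "moment c m (Q n) = (if m = int n + 1 then - rb (Suc n) * h n else 0)"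
      using m by (auto simp: moment_Q_above moment_Q_eq_0)
    moreover have "moment c (m - 1) (Q n) = (if m = 1 then h n else 0)"
      using m by (auto simp: moment_Q_0 moment_Q_eq_0)
    moreover have "moment c (m - 1) (P n) = (if m = int n + 1 then h n else 0)"
      using m by (auto simp: moment_P_top moment_P_eq_0)
    moreover have "moment c (m - 2) (P n) = (if m = 1 then - r (Suc n) * h n else 0)"
      using m by (auto simp: moment_P_below moment_P_eq_0)
    ultimately show "moment c m ?p = 0"
      unfolding moment_diff moment_X_pderiv[OF moment_rec]
      by (simp add: moment_add moment_minus moment_smult moment_pCons algebra_simps)
  next
    fix i assume "Suc n < i"
    then obtain j where i: "i = Suc (Suc j)" and "n \<le> j"
      by (cases i; cases "i - 1") auto
    then consider "j = n" | "n < j" by linarith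
    then show "coeff ?p i = 0"
      by cases (simp_all add: i coeff_pderiv)
  qed (simp add: coeff_pCons algebra_simps)
  then show ?thesis by simp
qed

lemma P_at_minus_1:
  "(\<nu> + t * r (Suc n) * rb n) * poly (P n) (-1)
    = (t * r (Suc n) + (of_nat n + \<nu>) * r n) * poly (Q n) (-1)"
  using arg_cong[OF P_diff_eq[of n], of "\<lambda>p. poly p (-1)"] by (simp add: algebra_simps)

lemma Q_at_minus_1:
  "(t * rb n + (of_nat n + 1 + \<nu>) * rb (Suc n)) * poly (P n) (-1)
    = (t * r (Suc n) * rb n - \<mu>) * poly (Q n) (-1)"
  using arg_cong[OF Q_diff_eq[of n], of "\<lambda>p. poly p (-1)"] by (simp add: algebra_simps)

text \<open>The second relation at \<open>N = n + 1\<close> in factored form; the product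
  \<open>t r (Suc n) * t rb n\<close> accounts for \<open>-t\<close> in
  \<open>t(\<nu> - \<mu> - t)\<close>.\<close>

lemma second_recurrence:
  "(\<nu> + t * r (Suc n) * rb n) * (t * r (Suc n) * rb n - \<mu>)
    = (t * r (Suc n) + (of_nat n + \<nu>) * r n) * (t * rb n + (of_nat n + 1 + \<nu>) * rb (Suc n))"
  by (rule det_eq_0_if_kernel[OF P_at_minus_1 Q_at_minus_1 P_Q_no_common_root]) simp

lemma first_recurrence:
  fixes n defines "N \<equiv> Suc n"
  shows "(1 - r N * rb N) * (t * r (Suc N) + (of_nat N + \<nu>) * r N) * (t * rb n + (of_nat N + \<nu>) * rb N)
    = ((of_nat N + \<nu>) * r N * rb N + \<mu>) * (\<nu> - (of_nat N + \<nu>) * r N * rb N)"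
proof -
  let ?x = "poly (P N) (-1)" and ?y = "poly (Q n) (-1)"
  \<comment> \<open>The Szego recurrence at \<open>z = -1\<close> rewrites the P-equation at level
    \<open>N\<close> and the Q-equation at level \<open>n\<close> in the same unknowns
    \<open>?x\<close>, \<open>?y\<close>.\<close>
  have P: "poly (P n) (-1) = r N * ?y - ?x"
    by (simp add: N_def P_Suc algebra_simps)
  have Q: "poly (Q N) (-1) = (1 - r N * rb N) * ?y + rb N * ?x"
    by (simp add: N_def P_Suc Q_Suc algebra_simps)
  have 1: "(\<nu> - (of_nat N + \<nu>) * r N * rb N) * ?x
      = ((1 - r N * rb N) * (t * r (Suc N) + (of_nat N + \<nu>) * r N)) * ?y"
    using P_at_minus_1[of N] unfolding Q by (simp add: algebra_simps)
  have 2: "(t * rb n + (of_nat N + \<nu>) * rb N) * ?x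
      = ((of_nat N + \<nu>) * r N * rb N + \<mu>) * ?y"
    using Q_at_minus_1[of n] unfolding P by (simp add: N_def algebra_simps)
  have "\<not> (?x = 0 \<and> ?y = 0)"
    using P_Q_no_common_root[of "-1" n] P by auto
  from det_eq_0_if_kernel[OF 1 2 this] show ?thesis
    by (simp add: mult.commute)
qed

end

section \<open>Fourier coefficients of the weight\<close>

text \<open>
  Both parts come from the derivative of \<open>F(\<theta>) = (1 + z) w(z) z\<^sup>-\<^sup>k\<close>, which is continuous up to the
  end points. It is \<open>\<i> w z\<^sup>-\<^sup>k\<close> times a quadratic polynomial whose value at \<open>z = -1\<close> is
  \<open>-(\<mu> + \<nu> + 1) \<noteq> 0\<close>, so \<open>w z\<^sup>-\<^sup>k\<close> is a combination of \<open>F'\<close> and continuous functions, hence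
  integrable without any estimate of its singularity.
\<close>

lemma weight_integrals:
  fixes \<mu> \<nu> t :: complex and k :: int
  assumes "Re (\<mu> + \<nu>) > -1"
  defines "g \<equiv> \<lambda>\<theta>. weight \<mu> \<nu> t (cis \<theta>) * exp (- \<i> * of_int k * of_real \<theta>)"
  shows "((\<lambda>\<theta>. (t * cis \<theta> ^ 2 + (t + \<mu> + 1 - of_int k) * cis \<theta> - (\<nu> + of_int k)) * g \<theta>)
      has_integral 0) {- pi..pi}"
    and "g integrable_on {- pi..pi}"
proof -
  define s where "s = \<mu> + \<nu> + 1"
  \<comment> \<open>\<open>\<kappa>\<close> collects the phases of \<open>w\<close>, of
    \<open>z^(-k)\<close> and of \<open>1 + z = 2 cos(\<theta>/2) e^(i\<theta>/2)\<close>; the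
    modulus raises the power of the cosine to \<open>s\<close>.\<close>
  define \<kappa> where "\<kappa> = (\<mu> - \<nu> + 1) / 2 - of_int k"
  define E where "E = (\<lambda>z. exp (\<i> * z * \<kappa> + t * exp (\<i> * z)))"
  define F where "F = (\<lambda>z. E z * (2 * cos (z / 2)) powr s)"
  define f where "f = (\<lambda>\<theta>. \<i> * (t * cis \<theta> ^ 2 + (t + \<mu> + 1 - of_int k) * cis \<theta> - (\<nu> + of_int k)) * g \<theta>)"
  have s: "Re s > 0" using assms(1) by (simp add: s_def)
  have cosr: "2 * cos (complex_of_real \<theta> / 2) = of_real (2 * cos (\<theta> / 2))" for \<theta>
    by (simp flip: cos_of_real)
  \<comment> \<open>The base vanishes at the end points; \<open>Re s > 0\<close> keeps the power
    continuous there.\<close>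
  have cont: "continuous_on {- pi..pi} (\<lambda>\<theta>. F (of_real \<theta>))"
    unfolding F_def E_def cosr
    by (intro continuous_intros) (auto intro!: cos_ge_zero s)
  have F_eq: "(1 + cis \<theta>) * g \<theta> = F (of_real \<theta>)"
    and F_deriv: "((\<lambda>\<theta>. F (of_real \<theta>)) has_vector_derivative f \<theta>) (at \<theta>)"
    if "\<theta> \<in> {- pi<..<pi}" for \<theta>
  proof -
    define \<rho> where "\<rho> = 2 * cos (\<theta> / 2)"
    \<comment> \<open>In terms of \<open>u\<close> the derivative formula becomes a rational
      identity.\<close>
    define u where "u = exp (\<i> * of_real \<theta> / 2)"
    define R where "R = complex_of_real \<rho> powr (\<mu> + \<nu>)"
    have \<rho>: "\<rho> > 0"
      using that by (auto simp: \<rho>_def intro!: cos_gt_zero_pi)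
    have u: "u \<noteq> 0" by (simp add: u_def)
    have cis: "cis \<theta> = u\<^sup>2" "exp (\<i> * of_real \<theta>) = u\<^sup>2"
      by (simp_all add: u_def cis_conv_exp flip: exp_double)
    have rho_u: "of_real \<rho> = u + 1 / u"
      by (simp add: \<rho>_def u_def cos_exp_eq cos_of_real [symmetric] exp_minus field_simps)
    have sin_u: "sin (complex_of_real \<theta> / 2) = (u - 1 / u) / (2 * \<i>)"
      by (simp add: u_def sin_exp_eq exp_minus field_simps)
    have fac: "1 + cis \<theta> = of_real \<rho> * u"
      using u unfolding rho_u cis by (simp add: field_simps power2_eq_square)
    have norm: "cmod (1 + cis \<theta>) = \<rho>"
      using \<rho> unfolding fac by (simp add: norm_mult u_def)
    have "weight \<mu> \<nu> t (cis \<theta>)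
        = exp (\<i> * of_real \<theta> * (\<mu> - \<nu>) / 2) * R * exp (t * cis \<theta>)"
      using that by (subst weight_cis) (auto simp: norm R_def)
    moreover have "exp (\<i> * of_real \<theta> * (\<mu> - \<nu>) / 2) * exp (t * cis \<theta>) * exp (- \<i> * of_int k * of_real \<theta>) * u
        = E (of_real \<theta>)"
      unfolding E_def u_def cis_conv_exp \<kappa>_def exp_add[symmetric]
      by (rule arg_cong[where f = exp]) (simp add: field_simps)
    ultimately have g: "g \<theta> * u = E (of_real \<theta>) * R"
      by (simp add: g_def algebra_simps)
    have pw: "complex_of_real \<rho> powr s = of_real \<rho> * R"
      using \<rho> by (simp add: s_def R_def powr_add)
    show "(1 + cis \<theta>) * g \<theta> = F (of_real \<theta>)"
      unfolding F_def cosr \<rho>_def[symmetric] pw fac using g by (simp add: algebra_simps)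
    have s1: "s - 1 = \<mu> + \<nu>" by (simp add: s_def)
    have nn: "2 * cos (complex_of_real \<theta> / 2) \<notin> \<real>\<^sub>\<le>\<^sub>0"
      unfolding cosr \<rho>_def[symmetric] using \<rho> by simp
    have cos_deriv: "((\<lambda>z. 2 * cos (z / 2)) has_field_derivative - sin (complex_of_real \<theta> / 2))
        (at (of_real \<theta>))"
      by (auto intro!: derivative_eq_intros)
    have "(F has_field_derivative
        (E (of_real \<theta>) * (\<i> * \<kappa> + t * (\<i> * exp (\<i> * of_real \<theta>))) * (2 * cos (complex_of_real \<theta> / 2)) powr s
        + E (of_real \<theta>) * (s * (2 * cos (complex_of_real \<theta> / 2)) powr (s - 1) * (- sin (complex_of_real \<theta> / 2)))))
        (at (of_real \<theta>))"
      unfolding F_def E_def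
      by (rule derivative_eq_intros refl DERIV_chain2[OF has_field_derivative_powr cos_deriv] nn)+
        (simp add: algebra_simps)
    also have "E (of_real \<theta>) * (\<i> * \<kappa> + t * (\<i> * exp (\<i> * of_real \<theta>))) * (2 * cos (complex_of_real \<theta> / 2)) powr s
        + E (of_real \<theta>) * (s * (2 * cos (complex_of_real \<theta> / 2)) powr (s - 1) * (- sin (complex_of_real \<theta> / 2)))
        = E (of_real \<theta>) * R * (\<i> * (\<kappa> + t * u\<^sup>2) * (u + 1 / u) - s * (u - 1 / u) / (2 * \<i>))"
      unfolding cosr \<rho>_def[symmetric] pw sin_u cis rho_u[symmetric] s1 R_def[symmetric]
      by (simp add: algebra_simps)
    also have "\<dots> = f \<theta>"
      using u unfolding g[symmetric] f_def cis s_def \<kappa>_def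
      by (simp add: field_simps power2_eq_square)
    finally show "((\<lambda>\<theta>. F (of_real \<theta>)) has_vector_derivative f \<theta>) (at \<theta>)"
      by (rule has_vector_derivative_real_field)
  qed
  have "(f has_integral (F (of_real pi) - F (of_real (- pi)))) {- pi..pi}"
    by (rule fundamental_theorem_of_calculus_interior) (use cont F_deriv in auto)
  moreover have "F (of_real pi) = 0" "F (of_real (- pi)) = 0"
    unfolding F_def cosr by simp_all
  ultimately have f: "(f has_integral 0) {- pi..pi}" by simp
  from has_integral_mult_right[OF f, of "- \<i>"]
  show "((\<lambda>\<theta>. (t * cis \<theta> ^ 2 + (t + \<mu> + 1 - of_int k) * cis \<theta> - (\<nu> + of_int k)) * g \<theta>)
      has_integral 0) {- pi..pi}"
    by (simp add: f_def mult.assoc[symmetric])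
  \<comment> \<open>Dividing the quadratic by \<open>1 + z\<close> gives quotient
    \<open>t z + (\<mu> + 1 - k)\<close> and remainder \<open>-s\<close>; \<open>?G\<close> is the
    result solved for \<open>g\<close>.\<close>
  let ?G = "\<lambda>\<theta>. (\<i> * f \<theta> + (t * cis \<theta> + (\<mu> + 1 - of_int k)) * F (of_real \<theta>)) / s"
  have "continuous_on {- pi..pi} (\<lambda>\<theta>. (t * cis \<theta> + (\<mu> + 1 - of_int k)) * F (of_real \<theta>))"
    by (intro continuous_intros cont)
  then have "?G integrable_on {- pi..pi}"
    using has_integral_integrable[OF has_integral_mult_right[OF f, of \<i>]]
    by (intro integrable_on_divide integrable_add) (auto intro: integrable_continuous_real)
  then show "g integrable_on {- pi..pi}"
  proof (rule integrable_spike_finite[where S = "{- pi, pi}", rotated 2])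
    fix \<theta> assume "\<theta> \<in> {- pi..pi} - {- pi, pi}"
    then have "F (of_real \<theta>) = (1 + cis \<theta>) * g \<theta>" by (subst F_eq) auto
    moreover have "s \<noteq> 0" using s by auto
    ultimately show "g \<theta> = ?G \<theta>"
      by (simp add: f_def s_def field_simps power2_eq_square)
  qed simp
qed

lemma fourier_coeff_weight_rec:
  fixes \<mu> \<nu> t :: complex and k :: int
  assumes "Re (\<mu> + \<nu>) > -1"
  defines "c \<equiv> fourier_coeff (weight \<mu> \<nu> t)"
  shows "(of_int k + \<nu>) * c k + (of_int k - 1 - \<mu> - t) * c (k - 1) - t * c (k - 2) = 0"
proof -
  define g where "g = (\<lambda>k \<theta>. weight \<mu> \<nu> t (cis \<theta>) * exp (- \<i> * of_int k * of_real \<theta>))"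
  \<comment> \<open>Integrability matters here: \<open>integral\<close> defaults to 0 otherwise, and
    linearity would fail.\<close>
  have c: "(g k has_integral (2 * of_real pi * c k)) {- pi..pi}" for k
    using weight_integrals(2)[OF assms(1), of t k]
    by (simp add: g_def c_def fourier_coeff_def has_integral_integral)
  have g1: "g (k - 1) \<theta> = cis \<theta> * g k \<theta>" for k \<theta>
    by (simp add: g_def cis_conv_exp algebra_simps flip: exp_add)
  have g2: "g (k - 2) \<theta> = cis \<theta> ^ 2 * g k \<theta>" for \<theta>
    using g1[of k] g1[of "k - 1"] by (simp add: power2_eq_square)
  have "((\<lambda>\<theta>. t * g (k - 2) \<theta> + (t + \<mu> + 1 - of_int k) * g (k - 1) \<theta> - (\<nu> + of_int k) * g k \<theta>)
      has_integral 0) {- pi..pi}"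
    using weight_integrals(1)[OF assms(1), of t k]
    by (simp add: g1 g2 algebra_simps flip: g_def) (simp add: g_def algebra_simps)
  moreover have "((\<lambda>\<theta>. t * g (k - 2) \<theta> + (t + \<mu> + 1 - of_int k) * g (k - 1) \<theta> - (\<nu> + of_int k) * g k \<theta>)
      has_integral t * (2 * of_real pi * c (k - 2)) + (t + \<mu> + 1 - of_int k) * (2 * of_real pi * c (k - 1))
        - (\<nu> + of_int k) * (2 * of_real pi * c k)) {- pi..pi}"
    by (intro has_integral_add has_integral_diff has_integral_mult_right c)
  ultimately have "2 * of_real pi * (t * c (k - 2) + (t + \<mu> + 1 - of_int k) * c (k - 1)
      - (\<nu> + of_int k) * c k) = 0"
    by (auto dest: has_integral_unique simp: algebra_simps)
  then have "t * c (k - 2) + (t + \<mu> + 1 - of_int k) * c (k - 1) - (\<nu> + of_int k) * c k = 0"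
    by simp
  then show ?thesis
    by (simp add: algebra_simps)
qed

theorem theorem4p1:
  fixes \<mu> \<nu> t :: complex and w :: "complex \<Rightarrow> complex" and r rb :: "nat \<Rightarrow> complex"
  assumes "Re (\<mu> + \<nu>) > -1"
    and "w = weight \<mu> \<nu> t"
    and "\<And>N. N \<ge> 1 \<Longrightarrow> toeplitz_det 0 N w \<noteq> 0"
    and "r = refl_coeff w"
    and "rb = refl_coeff_bar w"
  shows "\<forall>N\<ge>1.
    (1 - r N * rb N) * (t * r (N + 1) + (of_nat N + \<nu>) * r N) * (t * rb (N - 1) + (of_nat N + \<nu>) * rb N)
      = ((of_nat N + \<nu>) * r N * rb N + \<mu>) * (\<nu> - (of_nat N + \<nu>) * r N * rb N)
    \<and>
    t\<^sup>2 * (r N)\<^sup>2 * (rb (N - 1))\<^sup>2 + t * (\<nu> - \<mu> - t) * r N * rb (N - 1)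
      - (of_nat N + \<nu>) * (of_nat N - 1 + \<nu>) * rb N * r (N - 1)
      - (of_nat N - 1 + \<nu>) * t * r (N - 1) * rb (N - 1)
      - (of_nat N + \<nu>) * t * r N * rb N - \<mu> * \<nu> = 0"
proof (intro allI impI)
  fix N :: nat assume "N \<ge> 1"
  then obtain n where N: "N = Suc n" by (cases N) auto
  define c where "c = fourier_coeff w"
  have D: "Determinant.det (toeplitz c n) = toeplitz_det 0 n w" for n
    by (simp add: toeplitz_def toeplitz_det_def c_def)
  interpret m: semiclassical_moments c \<mu> \<nu> t
  proof
    show "Determinant.det (toeplitz c n) \<noteq> 0" for n
      \<comment> \<open>The hypothesis starts at \<open>N = 1\<close>; for \<open>n = 0\<close> the
        empty determinant is 1.\<close>
      using assms(3)[of n] by (cases n) (auto simp: D toeplitz_det_def)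
    show "(of_int k + \<nu>) * c k + (of_int k - 1 - \<mu> - t) * c (k - 1) - t * c (k - 2) = 0" for k
      unfolding c_def assms(2) by (rule fourier_coeff_weight_rec) (rule assms(1))
  qed
  have r: "r = m.r"
    by (rule ext) (simp add: assms(4) refl_coeff_def m.r_eq D toeplitz_det_def flip: c_def)
  have rb: "rb = m.rb"
    by (rule ext) (simp add: assms(5) refl_coeff_bar_def m.rb_eq D toeplitz_det_def flip: c_def)
  show "(1 - r N * rb N) * (t * r (N + 1) + (of_nat N + \<nu>) * r N) * (t * rb (N - 1) + (of_nat N + \<nu>) * rb N)
      = ((of_nat N + \<nu>) * r N * rb N + \<mu>) * (\<nu> - (of_nat N + \<nu>) * r N * rb N)
    \<and>
    t\<^sup>2 * (r N)\<^sup>2 * (rb (N - 1))\<^sup>2 + t * (\<nu> - \<mu> - t) * r N * rb (N - 1)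
      - (of_nat N + \<nu>) * (of_nat N - 1 + \<nu>) * rb N * r (N - 1)
      - (of_nat N - 1 + \<nu>) * t * r (N - 1) * rb (N - 1)
      - (of_nat N + \<nu>) * t * r N * rb N - \<mu> * \<nu> = 0"
    using m.first_recurrence[of n] m.second_recurrence[of n]
    unfolding r rb N by (auto simp: algebra_simps power2_eq_square)
qed

end
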